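(* Let $\beta,\delta\in C^2([0,1])$ be real-valued, and for every integer $N\ge 1$ let $B_N,D_N:[0,N]\to[0,\infty)$ be functions with $B_N(N)=0$ and $D_N(0)=0$. Assume there is a number $L$ such that for all $N\ge1$ and all $x\in[0,1]$ $$\left|\beta(x)-\frac{B_N(Nx)}{N}\right|\le\frac{L}{N},\qquad \left|\delta(x)-\frac{D_N(Nx)}{N}\right|\le\frac{L}{N}.$$ Let $T_N(t)=e^{A_N^{\top}t}$ be the semigroup on $\mathbb{C}^{N+1}$ generated by the transpose of the Kolmogorov matrix $A_N$ with birth rates $\beta_k=B_N(k)$ and death rates $\delta_k=D_N(k)$, let $(T(t)f)(x_0)=f(\varphi(t,x_0))$, where $t\mapsto\varphi(t,x_0)$ is the solution of $\dot x=\beta(x)-\delta(x)$, $x(0)=x_0\in[0,1]$, and let $P_N$ be the restriction of functions on $[0,1]$ to the grid $\{0,\frac1N,\dots,1\}$. Then for all $f\in C^2([0,1])$ and $t_0>0$ there exists $C=C(f,t_0)>0$, independent of $N$, such that for all $N\ge 1$ and all $t\in[0,t_0]$ $$\|(P_NT(t)-T_N(t)P_N)f\|\le\frac{C}{N}.$$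
   Context: The matrix $A_N$ is the $(N+1)\times(N+1)$ tridiagonal matrix, indexed by $0,\dots,N$, of the Kolmogorov equations $\dot p_k=\beta_{k-1}p_{k-1}-\alpha_kp_k+\delta_{k+1}p_{k+1}$ with $\alpha_k=\beta_k+\delta_k$: its entries are $(A_N)_{k,k}=-\alpha_k$, $(A_N)_{k,k-1}=\beta_{k-1}$, $(A_N)_{k,k+1}=\delta_{k+1}$, and all others are zero. The space $\mathbb{C}^{N+1}$ is identified with the space of functions on $\{0,\frac1N,\frac2N,\dots,1\}$ and carries the maximum norm $\|\cdot\|$. The operator $P_N$ is defined by $(P_Ng)(k/N)=g(k/N)$, $k=0,\dots,N$. Under the hypotheses $\beta,\delta\ge0$, $\beta(1)=0$, $\delta(0)=0$, so $\varphi(t,x_0)\in[0,1]$ is well defined for all $t\ge0$ and $x_0\in[0,1]$. *)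

theory Defs
  imports Complex_Main "Jordan_Normal_Form.Matrix"
begin

(* The derivatives are taken within S, so at the end points of S = {0..1} they are one-sided. *)
definition C2_on :: "real set \<Rightarrow> (real \<Rightarrow> 'a::real_normed_vector) \<Rightarrow> bool" where
  "C2_on S f \<longleftrightarrow> (\<exists>f' f''.
     (\<forall>x\<in>S. (f has_vector_derivative f' x) (at x within S)) \<and>
     (\<forall>x\<in>S. (f' has_vector_derivative f'' x) (at x within S)) \<and>
     continuous_on S f'')"

(* phi t x0 is the value at time t of the solution of x' = v x starting at x0.
   The vector field v is only meaningful on S, so a solution has values in S. *)
definition is_flow :: "(real \<Rightarrow> real) \<Rightarrow> real set \<Rightarrow> (real \<Rightarrow> real \<Rightarrow> real) \<Rightarrow> bool" where
  "is_flow v S \<phi> \<longleftrightarrow> (\<forall>x0\<in>S.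
     \<phi> 0 x0 = x0 \<and>
     (\<forall>t\<ge>0. \<phi> t x0 \<in> S \<and>
        ((\<lambda>s. \<phi> s x0) has_real_derivative v (\<phi> t x0)) (at t within {0..})))"

definition flow_semigroup ::
    "(real \<Rightarrow> real \<Rightarrow> real) \<Rightarrow> real \<Rightarrow> (real \<Rightarrow> complex) \<Rightarrow> real \<Rightarrow> complex" where
  "flow_semigroup \<phi> t f = (\<lambda>x0. f (\<phi> t x0))"

definition kolmogorov_mat :: "nat \<Rightarrow> (nat \<Rightarrow> real) \<Rightarrow> (nat \<Rightarrow> real) \<Rightarrow> complex mat" where
  "kolmogorov_mat N b d = mat (N + 1) (N + 1) (\<lambda>(k, j). complex_of_real
     (if j = k then - (b k + d k)
      else if k = j + 1 then b j
      else if j = k + 1 then d j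
      else 0))"

(* The exponential series of a square matrix, summed entrywise. *)
definition mat_exp :: "complex mat \<Rightarrow> complex mat" where
  "mat_exp M = mat (dim_row M) (dim_row M) (\<lambda>(i, j). \<Sum>n. (M ^\<^sub>m n) $$ (i, j) / fact n)"

definition kolmogorov_semigroup ::
    "nat \<Rightarrow> (nat \<Rightarrow> real) \<Rightarrow> (nat \<Rightarrow> real) \<Rightarrow> real \<Rightarrow> complex vec \<Rightarrow> complex vec" where
  "kolmogorov_semigroup N b d t g =
     mat_exp (complex_of_real t \<cdot>\<^sub>m transpose_mat (kolmogorov_mat N b d)) *\<^sub>v g"

(* A function on the grid {0, 1/N, ..., 1} is represented by the vector of its N + 1 values. *)
definition grid_restrict :: "nat \<Rightarrow> (real \<Rightarrow> complex) \<Rightarrow> complex vec" where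
  "grid_restrict N g = vec (N + 1) (\<lambda>k. g (real k / real N))"

definition max_norm :: "complex vec \<Rightarrow> real" where
  "max_norm v = Max ((\<lambda>i. cmod (v $ i)) ` {..<dim_vec v})"

end

theory Submission
  imports Defs "HOL-Analysis.Derivative"
begin

text \<open>
  Row \<open>k\<close> of the matrix exponential is the law of a birth-death chain \<open>X\<close> on the grid, started
  in \<open>k / N\<close>; let \<open>x\<close> be the flow line with the same initial value. The infinitesimal drift of
  \<open>X\<close> differs from the vector field by \<open>O(1/N)\<close> and its infinitesimal variance is \<open>O(1/N)\<close>, so
  Gronwall's inequality gives \<open>E (X - x)^2 = O(1/N)\<close>. Linearising the vector field at \<open>x\<close> leaves
  a remainder controlled by this second moment, and Gronwall's inequality gives
  \<open>\<bar>E (X - x)\<bar> = O(1/N)\<close>. A Taylor expansion of \<open>f\<close> at \<open>x\<close> then bounds \<open>E (f X) - f x\<close>.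
  Unlike the variation-of-constants formula, this needs no smoothness of the flow in its initial
  value.
\<close>

section \<open>Mean value and Taylor bounds for C^2 functions\<close>

lemma C2_on_diff:
  assumes "C2_on S f" and "C2_on S g"
  shows "C2_on S (\<lambda>x. f x - g x)"
proof -
  obtain f' f'' g' g'' where
    "\<And>x. x \<in> S \<Longrightarrow> (f has_vector_derivative f' x) (at x within S)"
    "\<And>x. x \<in> S \<Longrightarrow> (f' has_vector_derivative f'' x) (at x within S)"
    "continuous_on S f''"
    "\<And>x. x \<in> S \<Longrightarrow> (g has_vector_derivative g' x) (at x within S)"
    "\<And>x. x \<in> S \<Longrightarrow> (g' has_vector_derivative g'' x) (at x within S)"
    "continuous_on S g''"
    using assms unfolding C2_on_def by metis
  then show ?thesis
    unfolding C2_on_def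
    by (intro exI[of _ "\<lambda>x. f' x - g' x"] exI[of _ "\<lambda>x. f'' x - g'' x"])
      (auto intro!: has_vector_derivative_diff continuous_on_diff)
qed

lemma vector_derivative_bound:
  fixes f :: "real \<Rightarrow> 'a::real_normed_vector"
  assumes "convex S" and "\<And>x. x \<in> S \<Longrightarrow> (f has_vector_derivative f' x) (at x within S)"
    and "\<And>x. x \<in> S \<Longrightarrow> norm (f' x) \<le> M" and "x \<in> S" and "y \<in> S"
  shows "norm (f y - f x) \<le> M * \<bar>y - x\<bar>"
proof -
  have "norm (f y - f x) \<le> M * norm (y - x)"
  proof (rule differentiable_bound[OF assms(1)])
    show "(f has_derivative (\<lambda>h. h *\<^sub>R f' z)) (at z within S)" if "z \<in> S" for z
      using assms(2)[OF that] by (simp add: has_vector_derivative_def)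
    show "onorm (\<lambda>h. h *\<^sub>R f' z) \<le> M" if "z \<in> S" for z
    proof (rule onorm_le)
      show "norm (h *\<^sub>R f' z) \<le> M * norm h" for h :: real
        using mult_left_mono[OF assms(3)[OF that], of "\<bar>h\<bar>"] by (simp add: mult.commute)
    qed
  qed (use assms in auto)
  then show ?thesis by simp
qed

text \<open>By compactness one \<open>M\<close> bounds \<open>f\<close> and its first two
  derivatives. The quadratic bound is the mean value inequality for the function sending
  \<open>z\<close> to \<open>f z - z *\<^sub>R f' x\<close>: on the segment from \<open>x\<close> to
  \<open>y\<close> its derivative \<open>f' z - f' x\<close> has norm at most
  \<open>M * \<bar>y - x\<bar>\<close>. The factor 1/2 of Taylor's formula is given up. The general
  codomain serves the real vector field and the complex test function alike.\<close>

lemma C2_on_taylor: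
  fixes f :: "real \<Rightarrow> 'a::real_normed_vector"
  assumes "C2_on S f" and "compact S" and "convex S"
  obtains f' M where "M \<ge> 0"
    "\<And>x. x \<in> S \<Longrightarrow> norm (f x) \<le> M"
    "\<And>x. x \<in> S \<Longrightarrow> norm (f' x) \<le> M"
    "\<And>x y. x \<in> S \<Longrightarrow> y \<in> S \<Longrightarrow> norm (f y - f x) \<le> M * \<bar>y - x\<bar>"
    "\<And>x y. x \<in> S \<Longrightarrow> y \<in> S \<Longrightarrow> norm (f y - f x - (y - x) *\<^sub>R f' x) \<le> M * (y - x)\<^sup>2"
proof -
  obtain f' f'' where
    f': "\<And>x. x \<in> S \<Longrightarrow> (f has_vector_derivative f' x) (at x within S)" and
    f'': "\<And>x. x \<in> S \<Longrightarrow> (f' has_vector_derivative f'' x) (at x within S)" and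
    cont: "continuous_on S f''"
    using assms(1) unfolding C2_on_def by metis
  have "continuous_on S f" "continuous_on S f'"
    using f' f'' by (meson continuous_on_eq_continuous_within has_vector_derivative_continuous)+
  then have "bounded (f ` S \<union> f' ` S \<union> f'' ` S)"
    using cont assms(2) by (simp add: compact_continuous_image compact_imp_bounded)
  then obtain M where M0: "M > 0" and "\<forall>z \<in> f ` S \<union> f' ` S \<union> f'' ` S. norm z \<le> M"
    unfolding bounded_pos by blast
  then have M: "norm (f x) \<le> M" "norm (f' x) \<le> M" "norm (f'' x) \<le> M" if "x \<in> S" for x
    using that by blast+
  show thesis
  proof
    show "norm (f y - f x) \<le> M * \<bar>y - x\<bar>" if "x \<in> S" "y \<in> S" for x y
      using vector_derivative_bound[OF assms(3) f' M(2) that] .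
    show "norm (f y - f x - (y - x) *\<^sub>R f' x) \<le> M * (y - x)\<^sup>2" if "x \<in> S" "y \<in> S" for x y
    proof -
      have seg: "closed_segment x y \<subseteq> S"
        using assms(3) that by (simp add: closed_segment_subset)
      have "norm ((f y - y *\<^sub>R f' x) - (f x - x *\<^sub>R f' x)) \<le> M * \<bar>y - x\<bar> * \<bar>y - x\<bar>"
      proof (rule vector_derivative_bound[where S = "closed_segment x y" and f' = "\<lambda>z. f' z - f' x"])
        fix z assume z: "z \<in> closed_segment x y"
        show "((\<lambda>z. f z - z *\<^sub>R f' x) has_vector_derivative f' z - f' x)
            (at z within closed_segment x y)"
        proof -
          have "(f has_vector_derivative f' z) (at z within closed_segment x y)"
            using has_vector_derivative_within_subset[OF f' seg] z seg by blast
          then show ?thesis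
            by (auto intro!: derivative_eq_intros)
        qed
        have "norm (f' z - f' x) \<le> M * \<bar>z - x\<bar>"
          using vector_derivative_bound[OF assms(3) f'' M(3) that(1)] z seg by blast
        also have "\<dots> \<le> M * \<bar>y - x\<bar>"
          using M0 z by (intro mult_left_mono) (auto simp: closed_segment_eq_real_ivl split: if_splits)
        finally show "norm (f' z - f' x) \<le> M * \<bar>y - x\<bar>" .
      qed auto
      then show ?thesis
        by (simp add: algebra_simps power2_eq_square abs_mult_self_eq flip: abs_mult)
    qed
  qed (use M M0 in auto)
qed

section \<open>Gronwall's inequality and the squared negative part\<close>

lemma gronwall:
  fixes u u' :: "real \<Rightarrow> real"
  assumes u: "\<And>s. 0 \<le> s \<Longrightarrow> (u has_real_derivative u' s) (at s within {0..})"
    and le: "\<And>s. 0 \<le> s \<Longrightarrow> s \<le> T \<Longrightarrow> u' s \<le> a * u s + c"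
    and "u 0 = 0" and "a \<ge> 0" and "c \<ge> 0" and t: "t \<in> {0..T}"
  shows "u t \<le> c * T * exp (a * T)"
proof -
  \<comment> \<open>The integrating factor turns the hypothesis into \<open>h' \<le> 0\<close>: the
    bracket in \<open>h'\<close> is at most \<open>c\<close>, and the exponential is at most 1
    because \<open>a\<close> and \<open>s\<close> are nonnegative.\<close>
  define h where "h = (\<lambda>s. u s * exp (- a * s) - c * s)"
  define h' where "h' = (\<lambda>s. (u' s - a * u s) * exp (- a * s) - c)"
  have "(h has_real_derivative h' s) (at s within {0..t})" if "s \<in> {0..t}" for s
  proof -
    have "(u has_real_derivative u' s) (at s within {0..t})"
      by (rule DERIV_subset[OF u]) (use that in auto)
    then show ?thesis
      unfolding h_def h'_def by (auto intro!: derivative_eq_intros simp: algebra_simps)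
  qed
  then obtain s where s: "s \<in> {0..t}" and mvt: "h t - h 0 = h' s * (t - 0)"
    using mvt_very_simple[of 0 t h "\<lambda>s. (*) (h' s)"] t
    by (auto simp: has_field_derivative_def)
  have "h' s \<le> 0"
  proof -
    have "u' s - a * u s \<le> c"
      using le[of s] s t by auto
    then have "(u' s - a * u s) * exp (- a * s) \<le> c * 1"
      using s \<open>a \<ge> 0\<close> \<open>c \<ge> 0\<close> by (intro mult_mono) auto
    then show ?thesis by (simp add: h'_def)
  qed
  then have "h' s * t \<le> 0"
    using t by (intro mult_nonpos_nonneg) auto
  with mvt have "h t \<le> h 0"
    by simp
  then have "u t * exp (- a * t) \<le> c * t"
    using assms by (simp add: h_def)
  then have "u t * exp (- a * t) * exp (a * t) \<le> c * t * exp (a * t)"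
    by (rule mult_right_mono) simp
  moreover have "exp (- a * t) * exp (a * t) = 1"
    by (simp flip: exp_add)
  ultimately have "u t \<le> c * t * exp (a * t)"
    by (simp only: mult.assoc mult_1_right)
  also have "\<dots> \<le> c * T * exp (a * T)"
    using assms t by (intro mult_mono) (auto intro: mult_left_mono)
  finally show ?thesis .
qed

text \<open>Squaring removes the kink of \<open>min 0 x\<close> at 0, where the difference quotient
  is bounded by \<open>\<bar>h\<bar>\<close>. This makes the negative parts of the transition
  probabilities accessible to Gronwall's inequality.\<close>

lemma has_real_derivative_negative_part_square:
  "((\<lambda>x::real. (min 0 x)\<^sup>2) has_real_derivative 2 * min 0 x) (at x)"
proof -
  consider "x < 0" | "x = 0" | "x > 0" by linarith
  then show ?thesis
  proof cases
    case 1
    have "((\<lambda>x::real. x\<^sup>2) has_real_derivative 2 * min 0 x) (at x)"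
      using 1 by (auto intro!: derivative_eq_intros)
    then show ?thesis
      by (rule has_field_derivative_transform_within_open[where S = "{..<0}"]) (use 1 in auto)
  next
    case 2
    have "((\<lambda>h::real. (min 0 h)\<^sup>2 / h) \<longlongrightarrow> 0) (at 0)"
    proof (rule Lim_null_comparison)
      show "\<forall>\<^sub>F h in at (0::real). norm ((min 0 h)\<^sup>2 / h) \<le> \<bar>h\<bar>"
        by (rule always_eventually) (auto simp: min_def power2_eq_square)
    qed (auto intro!: tendsto_eq_intros)
    then show ?thesis
      using 2 by (simp add: has_field_derivative_iff)
  next
    case 3
    have "((\<lambda>x::real. 0) has_real_derivative 2 * min 0 x) (at x)"
      using 3 by (auto intro!: derivative_eq_intros)
    then show ?thesis
      by (rule has_field_derivative_transform_within_open[where S = "{0<..}"]) (use 3 in auto)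
  qed
qed

section \<open>Transition probabilities as power series\<close>

locale birth_death =
  fixes N :: nat and b d :: "nat \<Rightarrow> real"
  assumes b_nonneg: "k \<le> N \<Longrightarrow> 0 \<le> b k" and d_nonneg: "k \<le> N \<Longrightarrow> 0 \<le> d k"
    and b_top: "b N = 0" and d_bot: "d 0 = 0"
begin

text \<open>The transposed Kolmogorov matrix, that is, the rate matrix with the present state as row
  index, kept real so that order arguments apply.\<close>

definition rate :: "nat \<Rightarrow> nat \<Rightarrow> real" where
  "rate i j = (if i = j then - (b i + d i) else if j = i + 1 then b i
     else if i = j + 1 then d i else 0)"

definition rate_bound :: real where
  "rate_bound = (\<Sum>i\<le>N. \<Sum>j\<le>N. \<bar>rate i j\<bar>)"

text \<open>The powers of the rate matrix. Multiplying on the right matches the recursion of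
  \<open>^\<^sub>m\<close> and leads to the forward equation.\<close>

primrec rate_pow :: "nat \<Rightarrow> nat \<Rightarrow> nat \<Rightarrow> real" where
  "rate_pow 0 i j = (if i = j then 1 else 0)"
| "rate_pow (Suc n) i j = (\<Sum>l\<le>N. rate_pow n i l * rate l j)"

definition trans_prob :: "nat \<Rightarrow> nat \<Rightarrow> real \<Rightarrow> real" where
  "trans_prob i j t = (\<Sum>n. rate_pow n i j / fact n * t ^ n)"

lemma rate_sum_le: "j \<le> N \<Longrightarrow> (\<Sum>i\<le>N. \<bar>rate i j\<bar>) \<le> rate_bound"
  unfolding rate_bound_def by (intro sum_mono member_le_sum) auto

lemma rate_bound_nonneg: "0 \<le> rate_bound"
  unfolding rate_bound_def by (intro sum_nonneg) auto

lemma rate_le: "i \<le> N \<Longrightarrow> j \<le> N \<Longrightarrow> \<bar>rate i j\<bar> \<le> rate_bound"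
  by (rule order.trans[OF member_le_sum rate_sum_le]) auto

lemma rate_pow_le: "j \<le> N \<Longrightarrow> \<bar>rate_pow n i j\<bar> \<le> rate_bound ^ n"
proof (induction n arbitrary: j)
  case (Suc n)
  have "\<bar>rate_pow (Suc n) i j\<bar> \<le> (\<Sum>l\<le>N. \<bar>rate_pow n i l\<bar> * \<bar>rate l j\<bar>)"
    by (simp flip: abs_mult)
  also have "\<dots> \<le> (\<Sum>l\<le>N. rate_bound ^ n * \<bar>rate l j\<bar>)"
    using Suc.IH by (intro sum_mono mult_right_mono) auto
  also have "\<dots> \<le> rate_bound ^ n * rate_bound"
    unfolding sum_distrib_left[symmetric]
    using Suc.prems rate_bound_nonneg by (intro mult_left_mono rate_sum_le) auto
  finally show ?case by (simp add: mult.commute)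
qed simp

lemma summable_trans_prob:
  assumes "j \<le> N"
  shows "summable (\<lambda>n. rate_pow n i j / fact n * t ^ n)"
proof (rule summable_comparison_test')
  show "summable (\<lambda>n. inverse (fact n) * (rate_bound * \<bar>t\<bar>) ^ n)"
    by (rule summable_exp)
  show "norm (rate_pow n i j / fact n * t ^ n) \<le> inverse (fact n) * (rate_bound * \<bar>t\<bar>) ^ n"
    for n
    using rate_pow_le[OF assms, of n i]
    by (auto simp: abs_mult power_mult_distrib field_simps power_abs intro!: mult_left_mono)
qed

lemma trans_prob_0: "trans_prob i j 0 = (if i = j then 1 else 0)"
  unfolding trans_prob_def by (subst powser_zero) auto

text \<open>Kolmogorov's forward equation. In the termwise derivative the factor
  \<open>Suc n\<close> cancels against \<open>fact (Suc n)\<close>, and the recursion of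
  \<open>rate_pow\<close> splits off one rate matrix on the right.\<close>

lemma trans_prob_deriv:
  assumes "j \<le> N"
  shows "(trans_prob i j has_real_derivative (\<Sum>l\<le>N. trans_prob i l t * rate l j)) (at t)"
proof -
  have "(trans_prob i j has_real_derivative
      (\<Sum>n. diffs (\<lambda>n. rate_pow n i j / fact n) n * t ^ n)) (at t)"
    unfolding trans_prob_def
    by (rule termdiffs_strong_converges_everywhere) (rule summable_trans_prob[OF assms])
  also have "(\<lambda>n. diffs (\<lambda>n. rate_pow n i j / fact n) n * t ^ n)
      = (\<lambda>n. \<Sum>l\<le>N. (rate_pow n i l / fact n * t ^ n) * rate l j)"
  proof
    fix n
    have cancel: "real (Suc n) * (q / fact (Suc n)) = q / fact n" for q :: real
      by (simp del: of_nat_Suc)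
    show "diffs (\<lambda>n. rate_pow n i j / fact n) n * t ^ n
        = (\<Sum>l\<le>N. (rate_pow n i l / fact n * t ^ n) * rate l j)"
      unfolding diffs_def rate_pow.simps cancel
      by (simp add: sum_distrib_left sum_divide_distrib mult_ac)
  qed
  also have "(\<Sum>n. \<Sum>l\<le>N. (rate_pow n i l / fact n * t ^ n) * rate l j)
      = (\<Sum>l\<le>N. trans_prob i l t * rate l j)"
    unfolding trans_prob_def
    by (intro sums_unique[symmetric] sums_sum sums_mult2 summable_sums summable_trans_prob) auto
  finally show ?thesis .
qed

section \<open>Generator, conservation of mass and positivity\<close>

definition generator :: "(nat \<Rightarrow> real) \<Rightarrow> nat \<Rightarrow> real" where
  "generator g i = b i * (g (i + 1) - g i) + d i * (g (i - 1) - g i)"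

text \<open>Row \<open>i\<close> has at most three nonzero entries. At the ends of the grid the
  argument of \<open>g\<close> in \<open>generator\<close> would leave \<open>0..N\<close> or be
  truncated; \<open>b N = 0\<close> and \<open>d 0 = 0\<close> make these terms vanish.\<close>

lemma sum_rate:
  assumes "i \<le> N"
  shows "(\<Sum>j\<le>N. rate i j * g j) = generator g i"
proof -
  \<comment> \<open>For natural numbers \<open>i = i - 1\<close> means \<open>i = 0\<close>; there
    the indicators of \<open>i\<close> and \<open>i - 1\<close> coincide, and the downward term has
    to be zero.\<close>
  have "d i = 0" if "i = i - 1"
    using that d_bot by (cases i) auto
  moreover have "b i = 0" if "N < Suc i"
    using that assms b_top by (cases "i = N") auto
  ultimately have "(\<Sum>j\<le>N. rate i j * g j) =
    (\<Sum>j\<le>N. (if j = i then - (b i + d i) * g i else 0) + (if j = i + 1 then b i * g (i + 1) else 0)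
       + (if j = i - 1 then d i * g (i - 1) else 0))"
    by (intro sum.cong) (use d_bot in \<open>auto simp: rate_def\<close>)
  also have "\<dots> = - (b i + d i) * g i + b i * g (i + 1) + d i * g (i - 1)"
    using assms \<open>N < Suc i \<Longrightarrow> b i = 0\<close> by (auto simp: sum.distrib le_Suc_eq not_le)
  finally show ?thesis
    by (simp add: generator_def algebra_simps)
qed

text \<open>Dynkin's formula in differential form for a test function that also depends on time: the
  product rule gives \<open>g'\<close>, and the forward equation moves the rate matrix onto
  \<open>g t\<close>, where it acts as the generator. All moment estimates start from here.\<close>

lemma expectation_deriv:
  assumes "\<And>j. j \<le> N \<Longrightarrow> ((\<lambda>t. g t j) has_real_derivative g' j) (at t within S)"
  shows "((\<lambda>t. \<Sum>j\<le>N. trans_prob i j t * g t j) has_real_derivative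
     (\<Sum>j\<le>N. trans_prob i j t * (generator (g t) j + g' j))) (at t within S)"
proof -
  have "((\<lambda>t. \<Sum>j\<le>N. trans_prob i j t * g t j) has_real_derivative
     (\<Sum>j\<le>N. trans_prob i j t * g' j + (\<Sum>l\<le>N. trans_prob i l t * rate l j) * g t j))
     (at t within S)"
    by (intro DERIV_sum DERIV_mult' has_field_derivative_at_within[OF trans_prob_deriv] assms) auto
  also have "(\<Sum>j\<le>N. trans_prob i j t * g' j + (\<Sum>l\<le>N. trans_prob i l t * rate l j) * g t j)
    = (\<Sum>j\<le>N. trans_prob i j t * g' j) + (\<Sum>l\<le>N. trans_prob i l t * (\<Sum>j\<le>N. rate l j * g t j))"
    by (simp add: sum.distrib sum_distrib_left sum_distrib_right mult.assoc)
      (rule sum.swap)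
  also have "\<dots> = (\<Sum>j\<le>N. trans_prob i j t * (generator (g t) j + g' j))"
    by (simp add: sum_rate sum.distrib distrib_left)
  finally show ?thesis .
qed

text \<open>The generator annihilates constants, so the total mass keeps its initial value.\<close>

lemma sum_trans_prob:
  assumes "i \<le> N"
  shows "(\<Sum>j\<le>N. trans_prob i j t) = 1"
proof -
  have "\<exists>c. \<forall>t\<in>UNIV. (\<Sum>j\<le>N. trans_prob i j t * 1) = c"
    using expectation_deriv[where g = "\<lambda>_ _. 1" and g' = "\<lambda>_. 0" and i = i and S = UNIV]
    by (intro has_field_derivative_zero_constant) (auto simp: generator_def)
  then have "(\<Sum>j\<le>N. trans_prob i j t) = (\<Sum>j\<le>N. trans_prob i j 0)"
    by auto
  also have "\<dots> = 1"
    using assms by (simp add: trans_prob_0)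
  finally show ?thesis .
qed

lemma trans_prob_nonneg:
  assumes "0 \<le> t" and "j \<le> N"
  shows "0 \<le> trans_prob i j t"
proof -
  \<comment> \<open>The squares of the negative parts sum to a function \<open>u\<close> with \<open>u 0 = 0\<close> and \<open>u' \<le> R u\<close>,
    because the off-diagonal rates are nonnegative.\<close>
  define p where "p = (\<lambda>j t. trans_prob i j t)"
  define n where "n = (\<lambda>j t. min 0 (p j t))"
  define u where "u = (\<lambda>t. \<Sum>j\<le>N. (n j t)\<^sup>2)"
  define u' where "u' = (\<lambda>t. \<Sum>j\<le>N. 2 * n j t * (\<Sum>l\<le>N. p l t * rate l j))"
  define R where "R = (\<Sum>j\<le>N. \<Sum>l\<le>N. 2 * rate_bound)"
  have u: "(u has_real_derivative u' s) (at s within {0..})" for s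
    unfolding u_def u'_def n_def p_def
    by (intro DERIV_sum DERIV_chain2[OF has_real_derivative_negative_part_square]
        has_field_derivative_at_within[OF trans_prob_deriv]) auto
  have sq: "(n j s)\<^sup>2 \<le> u s" if "j \<le> N" for j s
    unfolding u_def using that by (intro member_le_sum) auto
  have le: "u' s \<le> R * u s + 0" for s
  proof -
    have "n j s * (p l s * rate l j) \<le> rate_bound * u s" if "j \<le> N" "l \<le> N" for j l
    proof (cases "l = j")
      case True
      \<comment> \<open>A negative part times its function is the square of the negative part, so
        the diagonal term has the sign of \<open>- (b j + d j)\<close>.\<close>
      have "n j s * (p j s * rate j j) = - (n j s)\<^sup>2 * (b j + d j)"
        by (auto simp: n_def rate_def power2_eq_square min_def algebra_simps)
      also have "\<dots> \<le> 0"
        using b_nonneg[OF that(1)] d_nonneg[OF that(1)] by (simp add: mult_nonneg_nonneg)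
      also have "\<dots> \<le> rate_bound * u s"
        using rate_bound_nonneg by (auto simp: u_def intro!: mult_nonneg_nonneg sum_nonneg)
      finally show ?thesis using True by simp
    next
      case False
      then have rate: "0 \<le> rate l j"
        using b_nonneg[OF that(2)] d_nonneg[OF that(2)] by (auto simp: rate_def)
      \<comment> \<open>Multiplying \<open>n l s \<le> p l s\<close> by the nonpositive
        \<open>n j s\<close> reverses the inequality.\<close>
      have "n j s * p l s \<le> n j s * n l s"
        by (intro mult_left_mono_neg) (auto simp: n_def)
      also have "\<dots> \<le> ((n j s)\<^sup>2 + (n l s)\<^sup>2) / 2"
        using sum_squares_bound[of "n j s" "n l s"] by simp
      also have "\<dots> \<le> u s"
        using sq[OF that(1), of s] sq[OF that(2), of s] by simp
      finally have "rate l j * (n j s * p l s) \<le> rate l j * u s"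
        using rate by (rule mult_left_mono)
      also have "\<dots> \<le> rate_bound * u s"
        using rate_le[OF that(2,1)] by (intro mult_right_mono) (auto simp: u_def sum_nonneg)
      finally show ?thesis by (simp add: mult_ac)
    qed
    then have "u' s \<le> (\<Sum>j\<le>N. \<Sum>l\<le>N. 2 * (rate_bound * u s))"
      unfolding u'_def sum_distrib_left by (intro sum_mono) (simp add: mult.assoc)
    then show ?thesis
      by (simp add: R_def mult_ac)
  qed
  \<comment> \<open>With additive constant 0, Gronwall's inequality forces
    \<open>u t \<le> 0\<close>, so every negative part vanishes.\<close>
  have "u t \<le> 0 * t * exp (R * t)"
  proof (rule gronwall[OF u le])
    show "u 0 = 0"
      unfolding u_def by (intro sum.neutral) (auto simp: n_def p_def trans_prob_0)
    show "0 \<le> R" unfolding R_def using rate_bound_nonneg by (intro sum_nonneg) auto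
  qed (use assms in auto)
  then have "(n j t)\<^sup>2 \<le> 0"
    using sq[OF assms(2), of t] by linarith
  then have "n j t = 0"
    by simp
  then show ?thesis
    unfolding n_def p_def by linarith
qed

lemma expectation_norm_le:
  fixes g :: "nat \<Rightarrow> 'a::real_normed_vector"
  assumes "0 \<le> t" and "\<And>j. j \<le> N \<Longrightarrow> norm (g j) \<le> h j"
  shows "norm (\<Sum>j\<le>N. trans_prob i j t *\<^sub>R g j) \<le> (\<Sum>j\<le>N. trans_prob i j t * h j)"
  using trans_prob_nonneg[OF assms(1)] assms(2)
  by (intro sum_norm_le) (auto intro!: mult_left_mono)

section \<open>Identification with the matrix exponential\<close>

lemma rate_pow_kolmogorov:
  assumes "i \<le> N" and "j \<le> N"
  shows "((complex_of_real t \<cdot>\<^sub>m transpose_mat (kolmogorov_mat N b d)) ^\<^sub>m n) $$ (i, j)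
     = complex_of_real (rate_pow n i j * t ^ n)"
  using assms(2)
proof (induction n arbitrary: j)
  case 0
  then show ?case using assms(1) by (simp add: kolmogorov_mat_def)
next
  case (Suc n)
  let ?M = "complex_of_real t \<cdot>\<^sub>m transpose_mat (kolmogorov_mat N b d)"
  have M: "?M \<in> carrier_mat (N + 1) (N + 1)"
    by (simp add: kolmogorov_mat_def)
  have "(?M ^\<^sub>m Suc n) $$ (i, j) = (\<Sum>l = 0..<N + 1. (?M ^\<^sub>m n) $$ (i, l) * ?M $$ (l, j))"
    using M pow_carrier_mat[OF M, of n] assms(1) Suc.prems
    by (simp add: scalar_prod_def del: index_smult_mat)
  also have "\<dots> = (\<Sum>l\<le>N. complex_of_real (rate_pow n i l * t ^ n * (t * rate l j)))"
    using Suc by (intro sum.cong)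
     (auto simp: kolmogorov_mat_def rate_def)
  also have "\<dots> = complex_of_real (rate_pow (Suc n) i j * t ^ Suc n)"
    by (simp add: sum_distrib_left sum_distrib_right mult_ac)
  finally show ?case .
qed

lemma dim_kolmogorov_semigroup: "dim_vec (kolmogorov_semigroup N b d t g) = N + 1"
  by (simp add: kolmogorov_semigroup_def mat_exp_def kolmogorov_mat_def)

text \<open>The entries of the exponential series are real, so the complex sum is the embedded
  \<open>trans_prob\<close>. The semigroup thus becomes the expectation over the chain started in
  \<open>i\<close>.\<close>

lemma kolmogorov_semigroup_index:
  assumes "i \<le> N" and "dim_vec g = N + 1"
  shows "kolmogorov_semigroup N b d t g $ i = (\<Sum>j\<le>N. trans_prob i j t *\<^sub>R g $ j)"
proof -
  let ?M = "complex_of_real t \<cdot>\<^sub>m transpose_mat (kolmogorov_mat N b d)"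
  have exp: "mat_exp ?M $$ (i, j) = complex_of_real (trans_prob i j t)" if "j \<le> N" for j
  proof -
    have "mat_exp ?M $$ (i, j) = (\<Sum>n. (?M ^\<^sub>m n) $$ (i, j) / fact n)"
      using assms that by (simp add: mat_exp_def kolmogorov_mat_def)
    also have "\<dots> = (\<Sum>n. complex_of_real (rate_pow n i j / fact n * t ^ n))"
      using assms that by (simp add: rate_pow_kolmogorov)
    also have "\<dots> = complex_of_real (trans_prob i j t)"
      unfolding trans_prob_def by (rule suminf_of_real[symmetric]) (rule summable_trans_prob[OF that])
    finally show ?thesis .
  qed
  have dim: "dim_row (mat_exp ?M) = N + 1" "dim_col (mat_exp ?M) = N + 1"
    by (simp_all add: mat_exp_def kolmogorov_mat_def)
  have "kolmogorov_semigroup N b d t g $ i = (\<Sum>j = 0..<N + 1. mat_exp ?M $$ (i, j) * g $ j)"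
    unfolding kolmogorov_semigroup_def using assms dim by (simp add: scalar_prod_def)
  also have "\<dots> = (\<Sum>j\<le>N. trans_prob i j t *\<^sub>R g $ j)"
    using exp by (intro sum.cong) (auto simp: scaleR_conv_of_real)
  finally show ?thesis .
qed

end

section \<open>Moments of the deviation from a flow line\<close>

locale approximated_flow = birth_death +
  fixes v v' x :: "real \<Rightarrow> real" and K \<Lambda> S :: real and i :: nat
  assumes N_pos: "N \<ge> 1" and start: "i \<le> N" "x 0 = real i / real N"
    and flow_mem: "\<And>t. 0 \<le> t \<Longrightarrow> x t \<in> {0..1}"
    and flow_deriv: "\<And>t. 0 \<le> t \<Longrightarrow> (x has_real_derivative v (x t)) (at t within {0..})"
    and drift: "\<And>j. j \<le> N \<Longrightarrow> \<bar>(b j - d j) / real N - v (real j / real N)\<bar> \<le> \<Lambda> / real N"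
    and speed: "\<And>j. j \<le> N \<Longrightarrow> (b j + d j) / real N \<le> S"
    and K_nonneg: "0 \<le> K"
    and v'_le: "\<And>z. z \<in> {0..1} \<Longrightarrow> \<bar>v' z\<bar> \<le> K"
    and v_lipschitz: "\<And>y z. y \<in> {0..1} \<Longrightarrow> z \<in> {0..1} \<Longrightarrow> \<bar>v y - v z\<bar> \<le> K * \<bar>y - z\<bar>"
    and v_taylor: "\<And>y z. y \<in> {0..1} \<Longrightarrow> z \<in> {0..1} \<Longrightarrow>
      \<bar>v y - v z - (y - z) * v' z\<bar> \<le> K * (y - z)\<^sup>2"
begin

definition state :: "nat \<Rightarrow> real" where "state j = real j / real N"

definition deviation :: "real \<Rightarrow> real" where
  "deviation t = (\<Sum>j\<le>N. trans_prob i j t * (state j - x t))"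

definition square_deviation :: "real \<Rightarrow> real" where
  "square_deviation t = (\<Sum>j\<le>N. trans_prob i j t * (state j - x t)\<^sup>2)"

lemma state_mem: "j \<le> N \<Longrightarrow> state j \<in> {0..1}"
  using N_pos by (simp add: state_def)

lemma bound_nonneg: "0 \<le> \<Lambda>" "0 \<le> S"
proof -
  have "0 \<le> \<Lambda> / real N"
    using drift[of 0] by linarith
  then show "0 \<le> \<Lambda>"
    using N_pos by (simp add: zero_le_divide_iff)
  have "0 \<le> (b 0 + d 0) / real N"
    using b_nonneg[of 0] d_nonneg[of 0] by simp
  then show "0 \<le> S"
    using speed[of 0] by linarith
qed

lemma expectation_mono:
  assumes "0 \<le> t" and "\<And>j. j \<le> N \<Longrightarrow> g j \<le> h j"
  shows "(\<Sum>j\<le>N. trans_prob i j t * g j) \<le> (\<Sum>j\<le>N. trans_prob i j t * h j)"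
  using trans_prob_nonneg[OF assms(1)] assms(2) by (intro sum_mono mult_left_mono) auto

text \<open>The constant passes through because the weights have total mass 1.\<close>

lemma expectation_affine:
  "(\<Sum>j\<le>N. trans_prob i j t * (a * g j + c)) = a * (\<Sum>j\<le>N. trans_prob i j t * g j) + c"
proof -
  have "(\<Sum>j\<le>N. trans_prob i j t * (a * g j + c))
      = a * (\<Sum>j\<le>N. trans_prob i j t * g j) + (\<Sum>j\<le>N. trans_prob i j t) * c"
    by (simp add: sum.distrib sum_distrib_left sum_distrib_right algebra_simps)
  then show ?thesis by (simp add: sum_trans_prob[OF start(1)])
qed

lemma generator_state:
  assumes "j \<le> N"
  shows "generator (\<lambda>j. state j - y) j = (b j - d j) / real N"
proof (cases j)
  case 0
  then show ?thesis
    using d_bot by (simp add: generator_def state_def)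
next
  case (Suc m)
  then show ?thesis
    using N_pos by (simp add: generator_def state_def field_simps)
qed

text \<open>A jump by \<open>h = 1 / N\<close> up or down changes \<open>e\<^sup>2\<close> by
  \<open>2 * e * h + h\<^sup>2\<close> or \<open>- 2 * e * h + h\<^sup>2\<close>. The linear parts
  give the drift; the quadratic parts give the variance term, which is \<open>O(1/N)\<close> since
  the total rate is \<open>O(N)\<close>.\<close>

lemma generator_state_square:
  assumes "j \<le> N"
  shows "generator (\<lambda>j. (state j - y)\<^sup>2) j
    = 2 * (state j - y) * ((b j - d j) / real N) + (b j + d j) / real N / real N"
proof -
  have up: "state (j + 1) = state j + 1 / real N"
    by (simp add: state_def add_divide_distrib)
  \<comment> \<open>At \<open>j = 0\<close> the truncated \<open>j - 1\<close> is not one grid step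
    down, but the factor \<open>d 0\<close> is zero.\<close>
  have down: "d j * ((state (j - 1) - y)\<^sup>2 - (state j - y)\<^sup>2)
      = d j * ((state j - 1 / real N - y)\<^sup>2 - (state j - y)\<^sup>2)"
    using d_bot by (cases j) (auto simp: state_def add_divide_distrib)
  show ?thesis
    unfolding generator_def down up by (simp add: power2_eq_square divide_inverse algebra_simps)
qed

text \<open>Gronwall's inequality with rate \<open>2 * K\<close> from the Lipschitz bound. The
  forcing consists of twice the drift error, where \<open>\<bar>state j - x s\<bar> \<le> 1\<close>
  is used, and of the variance term bounded through \<open>S\<close>.\<close>

lemma square_deviation_le:
  assumes t: "t \<in> {0..T}"
  shows "square_deviation t \<le> (2 * \<Lambda> + S) / real N * T * exp (2 * K * T)"
proof (rule gronwall[OF _ _ _ _ _ t])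
  define V' where "V' = (\<lambda>s. \<Sum>j\<le>N. trans_prob i j s *
    (generator (\<lambda>j. (state j - x s)\<^sup>2) j + 2 * (state j - x s) * (- v (x s))))"
  show "(square_deviation has_real_derivative V' s) (at s within {0..})" if "0 \<le> s" for s
    unfolding square_deviation_def V'_def
    by (rule expectation_deriv) (use flow_deriv[OF that] in \<open>auto intro!: derivative_eq_intros\<close>)
  show "V' s \<le> 2 * K * square_deviation s + (2 * \<Lambda> + S) / real N" if s: "0 \<le> s" for s
  proof -
    have "generator (\<lambda>j. (state j - x s)\<^sup>2) j + 2 * (state j - x s) * (- v (x s))
        \<le> 2 * K * (state j - x s)\<^sup>2 + (2 * \<Lambda> + S) / real N" if j: "j \<le> N" for j
    proof -
      let ?e = "state j - x s" and ?w = "(b j - d j) / real N"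
      have e: "\<bar>?e\<bar> \<le> 1"
        using state_mem[OF j] flow_mem[OF s] by auto
      have "?e * (?w - v (state j)) \<le> \<bar>?e\<bar> * \<bar>?w - v (state j)\<bar>"
        by (simp flip: abs_mult)
      also have "\<dots> \<le> 1 * (\<Lambda> / real N)"
        using e drift[OF j] by (intro mult_mono) (auto simp: state_def)
      finally have 1: "?e * (?w - v (state j)) \<le> \<Lambda> / real N" by simp
      have "?e * (v (state j) - v (x s)) \<le> \<bar>?e\<bar> * \<bar>v (state j) - v (x s)\<bar>"
        by (simp flip: abs_mult)
      also have "\<dots> \<le> \<bar>?e\<bar> * (K * \<bar>?e\<bar>)"
        by (intro mult_left_mono v_lipschitz state_mem flow_mem j s) auto
      also have "\<dots> = K * ?e\<^sup>2"
        by (simp add: power2_eq_square mult.left_commute)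
      finally have 2: "?e * (v (state j) - v (x s)) \<le> K * ?e\<^sup>2" .
      have 3: "(b j + d j) / real N / real N \<le> S / real N"
        using speed[OF j] by (intro divide_right_mono) auto
      \<comment> \<open>The value \<open>p = v (state j)\<close> is inserted between the drift
        \<open>w\<close> of the chain and the velocity \<open>q = v (x s)\<close> of the
        flow.\<close>
      have split: "2 * e * w + r + 2 * e * - q = 2 * (e * (w - p)) + 2 * (e * (p - q)) + r"
        for e w r p q :: real
        by (simp add: algebra_simps)
      have "generator (\<lambda>j. (state j - x s)\<^sup>2) j + 2 * ?e * (- v (x s))
        = 2 * (?e * (?w - v (state j))) + 2 * (?e * (v (state j) - v (x s)))
          + (b j + d j) / real N / real N"
        unfolding generator_state_square[OF j] by (rule split)
      also have "\<dots> \<le> 2 * (\<Lambda> / real N) + 2 * (K * ?e\<^sup>2) + S / real N"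
        using 1 2 3 by linarith
      finally show ?thesis
        by (simp add: add_divide_distrib)
    qed
    then show ?thesis
      unfolding V'_def square_deviation_def expectation_affine[symmetric]
      by (intro expectation_mono s) auto
  qed
  show "square_deviation 0 = 0"
    unfolding square_deviation_def using start
    by (intro sum.neutral) (auto simp: trans_prob_0 state_def)
qed (use K_nonneg bound_nonneg in auto)

text \<open>The second moment alone would only give order \<open>1 / sqrt N\<close>. Linearising
  \<open>v\<close> at \<open>x s\<close> yields a linear equation for the mean deviation, up to an
  error \<open>c / N\<close>: the nonlinear part is paid for by \<open>square_deviation\<close>, the
  rest by the drift error.\<close>

lemma deviation_le:
  assumes t: "t \<in> {0..T}" and c: "c = \<Lambda> + K * ((2 * \<Lambda> + S) * T * exp (2 * K * T))"
  shows "\<bar>deviation t\<bar> \<le> c / real N * sqrt (T * exp ((2 * K + 1) * T))"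
proof -
  define m' where "m' = (\<lambda>s. \<Sum>j\<le>N. trans_prob i j s *
    (generator (\<lambda>j. state j - x s) j + - v (x s)))"
  have m': "(deviation has_real_derivative m' s) (at s within {0..})" if "0 \<le> s" for s
    unfolding deviation_def m'_def
    by (rule expectation_deriv) (use flow_deriv[OF that] in \<open>auto intro!: derivative_eq_intros\<close>)
  have c0: "0 \<le> c"
    unfolding c using t K_nonneg bound_nonneg by auto
  have remainder: "\<bar>m' s - v' (x s) * deviation s\<bar> \<le> c / real N" if s: "0 \<le> s" "s \<le> T" for s
  proof -
    \<comment> \<open>\<open>r j\<close> is the drift error at \<open>state j\<close> plus the
      Taylor remainder of \<open>v\<close> at \<open>x s\<close>.\<close>
    define r where "r = (\<lambda>j. (b j - d j) / real N - v (x s) - (state j - x s) * v' (x s))"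
    have "m' s - v' (x s) * deviation s = (\<Sum>j\<le>N. trans_prob i j s *\<^sub>R r j)"
      unfolding m'_def deviation_def sum_distrib_left sum_subtractf[symmetric]
      by (intro sum.cong) (auto simp: generator_state r_def algebra_simps)
    also have "\<bar>\<dots>\<bar> \<le> (\<Sum>j\<le>N. trans_prob i j s * (K * (state j - x s)\<^sup>2 + \<Lambda> / real N))"
      unfolding real_norm_def[symmetric]
    proof (rule expectation_norm_le[OF s(1)])
      fix j assume j: "j \<le> N"
      show "norm (r j) \<le> K * (state j - x s)\<^sup>2 + \<Lambda> / real N"
        using drift[OF j] v_taylor[OF state_mem[OF j] flow_mem[OF s(1)]]
        unfolding r_def state_def real_norm_def by linarith
    qed
    also have "\<dots> = K * square_deviation s + \<Lambda> / real N"
      unfolding expectation_affine square_deviation_def ..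
    also have "\<dots> \<le> K * ((2 * \<Lambda> + S) / real N * T * exp (2 * K * T)) + \<Lambda> / real N"
      using square_deviation_le[of s T] s K_nonneg by (intro add_mono mult_left_mono) auto
    also have "\<dots> = c / real N"
      by (simp add: c algebra_simps add_divide_distrib)
    finally show ?thesis .
  qed
  \<comment> \<open>The square is differentiable where the absolute value need not be. The forcing
    is \<open>(c / N)\<^sup>2\<close>, so order \<open>1 / N\<close> is recovered by the square
    root; the 1 in \<open>2 * K + 1\<close> comes from splitting the product of deviation and error
    into squares.\<close>
  have "(deviation t)\<^sup>2 \<le> (c / real N)\<^sup>2 * T * exp ((2 * K + 1) * T)"
  proof (rule gronwall[OF _ _ _ _ _ t])
    show "((\<lambda>s. (deviation s)\<^sup>2) has_real_derivative 2 * deviation s * m' s) (at s within {0..})"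
      if "0 \<le> s" for s
      using m'[OF that] by (auto intro!: derivative_eq_intros)
    show "2 * deviation s * m' s \<le> (2 * K + 1) * (deviation s)\<^sup>2 + (c / real N)\<^sup>2"
      if s: "0 \<le> s" "s \<le> T" for s
    proof -
      let ?r = "m' s - v' (x s) * deviation s"
      have "2 * deviation s * ?r \<le> (deviation s)\<^sup>2 + ?r\<^sup>2"
        by (rule sum_squares_bound)
      also have "?r\<^sup>2 \<le> (c / real N)\<^sup>2"
        using remainder[OF s] c0 by (simp add: abs_le_square_iff[symmetric])
      finally have 1: "2 * deviation s * ?r \<le> (deviation s)\<^sup>2 + (c / real N)\<^sup>2" by simp
      have "v' (x s) * (deviation s)\<^sup>2 \<le> K * (deviation s)\<^sup>2"
        using v'_le[OF flow_mem[OF s(1)]] by (intro mult_right_mono) auto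
      with 1 show ?thesis
        by (simp add: algebra_simps power2_eq_square)
    qed
    have "deviation 0 = 0"
      unfolding deviation_def using start
      by (intro sum.neutral) (auto simp: trans_prob_0 state_def)
    then show "(deviation 0)\<^sup>2 = 0" by simp
  qed (use K_nonneg in auto)
  then have "sqrt ((deviation t)\<^sup>2) \<le> sqrt ((c / real N)\<^sup>2 * (T * exp ((2 * K + 1) * T)))"
    by (simp only: real_sqrt_le_iff mult.assoc)
  then show ?thesis
    using c0 by (simp add: real_sqrt_mult)
qed

text \<open>Taylor expansion of \<open>f\<close> at \<open>x t\<close>: the linear term averages to
  \<open>deviation t *\<^sub>R f' (x t)\<close>, and the remainder is bounded by
  \<open>F * square_deviation t\<close>. Both are \<open>O(1/N)\<close>.\<close>

lemma expectation_test_function_le: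
  fixes f f' :: "real \<Rightarrow> 'a::real_normed_vector"
  assumes t: "t \<in> {0..T}" and c: "c = (2 * \<Lambda> + S) * T * exp (2 * K * T)"
    and f': "\<And>z. z \<in> {0..1} \<Longrightarrow> norm (f' z) \<le> F"
    and taylor: "\<And>y z. y \<in> {0..1} \<Longrightarrow> z \<in> {0..1} \<Longrightarrow>
      norm (f y - f z - (y - z) *\<^sub>R f' z) \<le> F * (y - z)\<^sup>2"
  shows "norm (f (x t) - (\<Sum>j\<le>N. trans_prob i j t *\<^sub>R f (state j)))
    \<le> F * (c + (\<Lambda> + K * c) * sqrt (T * exp ((2 * K + 1) * T))) / real N"
proof -
  define r where "r = (\<lambda>j. f (state j) - f (x t) - (state j - x t) *\<^sub>R f' (x t))"
  have t0: "0 \<le> t" using t by simp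
  have F: "0 \<le> F"
    using f'[of 0] by (rule order.trans[OF norm_ge_zero]) auto
  have "(\<Sum>j\<le>N. trans_prob i j t *\<^sub>R f (state j))
    = (\<Sum>j\<le>N. trans_prob i j t *\<^sub>R r j + trans_prob i j t *\<^sub>R f (x t)
        + (trans_prob i j t * (state j - x t)) *\<^sub>R f' (x t))"
    by (intro sum.cong) (auto simp: r_def algebra_simps)
  also have "\<dots> = (\<Sum>j\<le>N. trans_prob i j t *\<^sub>R r j) + f (x t) + deviation t *\<^sub>R f' (x t)"
    by (simp add: sum.distrib deviation_def sum_trans_prob[OF start(1)] flip: scaleR_sum_left)
  finally have "f (x t) - (\<Sum>j\<le>N. trans_prob i j t *\<^sub>R f (state j))
    = - ((\<Sum>j\<le>N. trans_prob i j t *\<^sub>R r j) + deviation t *\<^sub>R f' (x t))"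
    by simp
  then have "norm (f (x t) - (\<Sum>j\<le>N. trans_prob i j t *\<^sub>R f (state j)))
    = norm ((\<Sum>j\<le>N. trans_prob i j t *\<^sub>R r j) + deviation t *\<^sub>R f' (x t))"
    by (simp only: norm_minus_cancel)
  also have "\<dots> \<le> norm (\<Sum>j\<le>N. trans_prob i j t *\<^sub>R r j) + norm (deviation t *\<^sub>R f' (x t))"
    by (rule norm_triangle_ineq)
  also have "\<dots> \<le> F * (c / real N)
      + (\<Lambda> + K * c) / real N * sqrt (T * exp ((2 * K + 1) * T)) * F"
  proof (rule add_mono)
    have "norm (\<Sum>j\<le>N. trans_prob i j t *\<^sub>R r j)
        \<le> (\<Sum>j\<le>N. trans_prob i j t * (F * (state j - x t)\<^sup>2))"
      unfolding r_def
      by (intro expectation_norm_le t0 taylor state_mem flow_mem)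
    also have "\<dots> = F * square_deviation t"
      by (simp add: square_deviation_def sum_distrib_left mult.left_commute)
    also have "\<dots> \<le> F * (c / real N)"
      using square_deviation_le[OF t] F by (intro mult_left_mono) (simp_all add: c)
    finally show "norm (\<Sum>j\<le>N. trans_prob i j t *\<^sub>R r j) \<le> F * (c / real N)" .
    have "\<bar>deviation t\<bar> \<le> (\<Lambda> + K * c) / real N * sqrt (T * exp ((2 * K + 1) * T))"
      by (rule deviation_le[OF t]) (simp add: c)
    then show "norm (deviation t *\<^sub>R f' (x t))
        \<le> (\<Lambda> + K * c) / real N * sqrt (T * exp ((2 * K + 1) * T)) * F"
      unfolding norm_scaleR
      using f'[OF flow_mem[OF t0]] by (intro mult_mono) (auto intro: order.trans[OF abs_ge_zero])
  qed
  finally show ?thesis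
    by (simp add: algebra_simps add_divide_distrib)
qed

end

section \<open>Constants uniform in \<open>N\<close> and the maximum over the grid\<close>

theorem lemma5:
  fixes \<beta> \<delta> :: "real \<Rightarrow> real"
    and B D :: "nat \<Rightarrow> real \<Rightarrow> real"
    and \<phi> :: "real \<Rightarrow> real \<Rightarrow> real"
  assumes "C2_on {0..1} \<beta>" and "C2_on {0..1} \<delta>"
    and "\<And>N x. N \<ge> 1 \<Longrightarrow> x \<in> {0..real N} \<Longrightarrow> B N x \<ge> 0"
    and "\<And>N x. N \<ge> 1 \<Longrightarrow> x \<in> {0..real N} \<Longrightarrow> D N x \<ge> 0"
    and "\<And>N. N \<ge> 1 \<Longrightarrow> B N (real N) = 0"
    and "\<And>N. N \<ge> 1 \<Longrightarrow> D N 0 = 0"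
    and "\<exists>L. \<forall>N\<ge>1. \<forall>x\<in>{0..1}.
           \<bar>\<beta> x - B N (real N * x) / real N\<bar> \<le> L / real N \<and>
           \<bar>\<delta> x - D N (real N * x) / real N\<bar> \<le> L / real N"
    and "is_flow (\<lambda>x. \<beta> x - \<delta> x) {0..1} \<phi>"
  shows "\<forall>f :: real \<Rightarrow> complex. C2_on {0..1} f \<longrightarrow> (\<forall>t0>0. \<exists>C>0. \<forall>N\<ge>1. \<forall>t\<in>{0..t0}.
           max_norm (grid_restrict N (flow_semigroup \<phi> t f)
             - kolmogorov_semigroup N (\<lambda>k. B N (real k)) (\<lambda>k. D N (real k)) t (grid_restrict N f))
           \<le> C / real N)"
proof (intro allI impI)
  fix f :: "real \<Rightarrow> complex" and t0 :: real
  assume "C2_on {0..1} f" and "t0 > 0"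
  obtain f' F where f: "F \<ge> 0" "\<And>x. x \<in> {0..1} \<Longrightarrow> norm (f' x) \<le> F"
    "\<And>x y. x \<in> {0..1} \<Longrightarrow> y \<in> {0..1} \<Longrightarrow> norm (f y - f x - (y - x) *\<^sub>R f' x) \<le> F * (y - x)\<^sup>2"
    using C2_on_taylor[OF \<open>C2_on {0..1} f\<close>] by (metis compact_Icc convex_real_interval(5))
  define v where "v = (\<lambda>x. \<beta> x - \<delta> x)"
  have "C2_on {0..1} v"
    unfolding v_def by (intro C2_on_diff assms)
  then obtain v' K where v: "K \<ge> 0" "\<And>x. x \<in> {0..1} \<Longrightarrow> norm (v' x) \<le> K"
    "\<And>x y. x \<in> {0..1} \<Longrightarrow> y \<in> {0..1} \<Longrightarrow> norm (v y - v x) \<le> K * \<bar>y - x\<bar>"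
    "\<And>x y. x \<in> {0..1} \<Longrightarrow> y \<in> {0..1} \<Longrightarrow> norm (v y - v x - (y - x) *\<^sub>R v' x) \<le> K * (y - x)\<^sup>2"
    by (rule C2_on_taylor) auto
  obtain M\<beta> where \<beta>: "\<And>x. x \<in> {0..1} \<Longrightarrow> \<bar>\<beta> x\<bar> \<le> M\<beta>"
    using C2_on_taylor[OF assms(1)] by (metis compact_Icc convex_real_interval(5) real_norm_def)
  obtain M\<delta> where \<delta>: "\<And>x. x \<in> {0..1} \<Longrightarrow> \<bar>\<delta> x\<bar> \<le> M\<delta>"
    using C2_on_taylor[OF assms(2)] by (metis compact_Icc convex_real_interval(5) real_norm_def)
  obtain L where L: "\<bar>\<beta> x - B N (real N * x) / real N\<bar> \<le> L / real N"
    "\<bar>\<delta> x - D N (real N * x) / real N\<bar> \<le> L / real N" if "N \<ge> 1" "x \<in> {0..1}" for N x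
    using assms(7) by blast
  have L0: "L \<ge> 0"
    using L(1)[of 1 0] by auto
  \<comment> \<open>The drift \<open>b - d\<close> collects the errors of both rates, hence
    \<open>2 * L\<close>. For the total rate the error \<open>2 * L / N\<close> is at most
    \<open>2 * L\<close>, as \<open>N \<ge> 1\<close>.\<close>
  define \<Lambda> where "\<Lambda> = 2 * L"
  define S where "S = M\<beta> + M\<delta> + 2 * L"
  define c where "c = (2 * \<Lambda> + S) * t0 * exp (2 * K * t0)"
  define C where "C = F * (c + (\<Lambda> + K * c) * sqrt (t0 * exp ((2 * K + 1) * t0)))"
  have "max_norm (grid_restrict N (flow_semigroup \<phi> t f)
      - kolmogorov_semigroup N (\<lambda>k. B N (real k)) (\<lambda>k. D N (real k)) t (grid_restrict N f))
      \<le> max 1 C / real N" (is "max_norm ?d \<le> _") if N: "N \<ge> 1" and t: "t \<in> {0..t0}" for N t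
  proof -
    have mem: "real k / real N \<in> {0..1}" if "k \<le> N" for k
      using that N by simp
    have rates: "\<bar>\<beta> (real k / real N) - B N (real k) / real N\<bar> \<le> L / real N"
      "\<bar>\<delta> (real k / real N) - D N (real k) / real N\<bar> \<le> L / real N" if "k \<le> N" for k
      using L[OF N mem[OF that]] N by simp_all
    interpret birth_death N "\<lambda>k. B N (real k)" "\<lambda>k. D N (real k)"
      using assms(3-6) N by unfold_locales auto
    have "norm (?d $ i) \<le> max 1 C / real N" if i: "i \<le> N" for i
    proof -
      \<comment> \<open>Each grid point has its own flow line, but \<open>K\<close>,
        \<open>\<Lambda>\<close> and \<open>S\<close> depend neither on \<open>i\<close> nor on
        \<open>N\<close>, so the bound passes to the maximum norm.\<close>
      interpret approximated_flow N "\<lambda>k. B N (real k)" "\<lambda>k. D N (real k)"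
        v v' "\<lambda>s. \<phi> s (real i / real N)" K \<Lambda> S i
      proof unfold_locales
        fix j assume j: "j \<le> N"
        show "\<bar>(B N (real j) - D N (real j)) / real N - v (real j / real N)\<bar> \<le> \<Lambda> / real N"
          using rates[OF j] by (simp add: v_def \<Lambda>_def diff_divide_distrib abs_le_iff)
        have "L / real N \<le> L"
          using L0 N by (simp add: divide_le_eq mult_le_cancel_left1)
        then show "(B N (real j) + D N (real j)) / real N \<le> S"
          using rates[OF j] \<beta>[OF mem[OF j]] \<delta>[OF mem[OF j]]
          by (simp add: S_def add_divide_distrib abs_le_iff)
      qed (use N i v mem[OF i] assms(8) in \<open>auto simp: is_flow_def v_def\<close>)
      have "norm (f (\<phi> t (real i / real N)) - (\<Sum>j\<le>N. trans_prob i j t *\<^sub>R f (state j)))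
          \<le> C / real N"
        unfolding C_def by (rule expectation_test_function_le[OF t c_def f(2,3)])
      also have "C / real N \<le> max 1 C / real N"
        by (intro divide_right_mono) auto
      finally show ?thesis
        using i by (simp add: kolmogorov_semigroup_index dim_kolmogorov_semigroup
          grid_restrict_def flow_semigroup_def state_def cong: sum.cong_simp)
    qed
    moreover have "dim_vec ?d = N + 1"
      by (simp add: dim_kolmogorov_semigroup)
    ultimately show ?thesis
      unfolding max_norm_def by (subst Max_le_iff) (auto simp: less_Suc_eq_le)
  qed
  then show "\<exists>C>0. \<forall>N\<ge>1. \<forall>t\<in>{0..t0}. max_norm (grid_restrict N (flow_semigroup \<phi> t f)
      - kolmogorov_semigroup N (\<lambda>k. B N (real k)) (\<lambda>k. D N (real k)) t (grid_restrict N f))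
      \<le> C / real N"
    by (intro exI[of _ "max 1 C"]) auto
qed

end
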